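(* For every integer $n \geq 1$, $N(n) \geq \left\lfloor \frac{2n+1}{3} \right\rfloor$.
   Context: For a positive integer $n$, the triangle of size $n$ is the set of cells $T_n = \{(a,b) : a,b \in \{1,\dots,n\},\ a+b \geq n+1\}$ of an $n\times n$ grid, where $a$ indexes rows from top to bottom and $b$ indexes columns from left to right (so $T_n$ consists of the cells on or below the longest southwest-to-northeast diagonal of the square). A row is a set of cells of $T_n$ with fixed $a$, a column is a set with fixed $b$, and a standard diagonal (southwest-to-northeast) is a set of cells of $T_n$ with fixed $a+b$. $N(n)$ denotes the maximum number of dots that can be placed into cells of $T_n$ (at most one dot per cell) such that each row, each column and each standard diagonal contains at most one dot. *)

theory Defs
  imports Complex_Main
begin

text \<open>A cell \<open>(a, b)\<close> lies in row \<open>a\<close> (counted from the top) and column \<open>b\<close>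
  (counted from the left).\<close>

definition triangle :: "nat \<Rightarrow> (nat \<times> nat) set" where
  "triangle n = {(a, b). a \<in> {1..n} \<and> b \<in> {1..n} \<and> a + b \<ge> n + 1}"

definition row :: "nat \<Rightarrow> nat \<Rightarrow> (nat \<times> nat) set" where
  "row n i = {(a, b). (a, b) \<in> triangle n \<and> a = i}"

definition column :: "nat \<Rightarrow> nat \<Rightarrow> (nat \<times> nat) set" where
  "column n j = {(a, b). (a, b) \<in> triangle n \<and> b = j}"

definition diagonal :: "nat \<Rightarrow> nat \<Rightarrow> (nat \<times> nat) set" where
  "diagonal n s = {(a, b). (a, b) \<in> triangle n \<and> a + b = s}"

text \<open>A placement is the set of dotted cells. The indices range over all naturals; out-of-range
  rows, columns and diagonals are empty. All sets involved are finite, so \<open>card\<close> counts.\<close>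

definition valid_placement :: "nat \<Rightarrow> (nat \<times> nat) set \<Rightarrow> bool" where
  "valid_placement n D \<longleftrightarrow>
     D \<subseteq> triangle n \<and>
     (\<forall>i. card (D \<inter> row n i) \<le> 1) \<and>
     (\<forall>j. card (D \<inter> column n j) \<le> 1) \<and>
     (\<forall>s. card (D \<inter> diagonal n s) \<le> 1)"

definition max_dots :: "nat \<Rightarrow> nat" where
  "max_dots n = Max {card D | D. valid_placement n D}"

lemma finite_triangle: "finite (triangle n)"
  by (rule finite_subset[of _ "{1..n} \<times> {1..n}"]) (auto simp: triangle_def)

text \<open>The maximum in \<open>max_dots\<close> is over a finite nonempty set, hence attained.\<close>

lemma finite_dot_counts: "finite {card D | D. valid_placement n D}"
proof -
  have "{card D | D. valid_placement n D} \<subseteq> card ` Pow (triangle n)"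
    by (auto simp: valid_placement_def)
  then show ?thesis
    by (rule finite_subset) (simp add: finite_triangle)
qed

lemma dot_counts_nonempty: "{card D | D. valid_placement n D} \<noteq> {}"
proof -
  have "valid_placement n {}"
    by (simp add: valid_placement_def)
  then show ?thesis by blast
qed

end

theory Submission
  imports Defs
begin

text \<open>Put \<open>k = n div 3\<close>. Use the rows \<open>n, n - 1, \<dots>, n - 2 k\<close>; going upwards, the columns
  descend from \<open>2 k + 1\<close> to \<open>k + 1\<close> and then from \<open>3 k + 1\<close> to \<open>2 k + 2\<close>. The values
  \<open>a + b - n - 1\<close> are the even numbers from \<open>2 k\<close> down to \<open>0\<close> and then the odd numbers from
  \<open>2 k - 1\<close> down to \<open>1\<close>, so no diagonal repeats. Only column \<open>3 k + 1\<close> can lie outside the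
  triangle, which happens exactly when \<open>n = 3 k\<close> and costs one dot.\<close>

definition dot :: "nat \<Rightarrow> nat \<Rightarrow> nat \<times> nat" where
  "dot n i = (let k = n div 3 in (n - i, if i \<le> k then 2 * k + 1 - i else 4 * k + 2 - i))"

text \<open>The index \<open>n div 3 + 1\<close> starts the second run of columns, so it is the one
  whose dot would sit in column \<open>3 * k + 1\<close>.\<close>

definition dot_indices :: "nat \<Rightarrow> nat set" where
  "dot_indices n = {..2 * (n div 3)} - (if n mod 3 = 0 then {n div 3 + 1} else {})"

lemma dot_in_triangle:
  assumes "n \<ge> 1" and "i \<in> dot_indices n"
  shows "dot n i \<in> triangle n"
proof -
  define k where "k = n div 3"
  have n: "3 * k \<le> n" "n \<le> 3 * k + 2" "n = 3 * k \<longleftrightarrow> n mod 3 = 0"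
    unfolding k_def by presburger+
  have i: "i \<le> 2 * k" "n = 3 * k \<longrightarrow> i \<noteq> k + 1"
    using assms(2) n(3) by (auto simp: dot_indices_def k_def split: if_splits)
  show ?thesis
  proof (cases "i \<le> k")
    case True
    then have "dot n i = (n - i, 2 * k + 1 - i)"
      by (simp add: dot_def k_def Let_def)
    moreover have "n - i \<ge> 1" "2 * k + 1 - i \<ge> 1" "2 * k + 1 - i \<le> n"
        "n - i + (2 * k + 1 - i) \<ge> n + 1"
      using True n i assms(1) by linarith+
    ultimately show ?thesis
      unfolding triangle_def atLeastAtMost_iff mem_Collect_eq by auto
  next
    case False
    then have "dot n i = (n - i, 4 * k + 2 - i)"
      by (simp add: dot_def k_def Let_def)
    \<comment> \<open>Here \<open>i \<ge> k + 1\<close>, so the column is at most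
      \<open>3 * k + 1\<close>; it could exceed \<open>n\<close> only for \<open>n = 3 * k\<close>
      and \<open>i = k + 1\<close>, the excluded index.\<close>
    moreover have "n - i \<ge> 1" "4 * k + 2 - i \<ge> 1" "4 * k + 2 - i \<le> n"
        "n - i + (4 * k + 2 - i) \<ge> n + 1"
      using False n i by linarith+
    ultimately show ?thesis
      unfolding triangle_def atLeastAtMost_iff mem_Collect_eq by auto
  qed
qed

lemma inj_on_dot_row: "inj_on (\<lambda>i. fst (dot n i)) (dot_indices n)"
  by (rule inj_onI) (auto simp: dot_def dot_indices_def Let_def split: if_splits)

text \<open>The bound \<open>i \<le> 2 * k\<close> keeps the second run of columns above
  \<open>2 * k + 1\<close>, hence disjoint from the first.\<close>

lemma inj_on_dot_column: "inj_on (\<lambda>i. snd (dot n i)) (dot_indices n)"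
  by (rule inj_onI) (auto simp: dot_def dot_indices_def Let_def split: if_splits)

text \<open>Row and column both drop by one per index; moving \<open>2 * i\<close> to the left
  avoids truncated subtraction.\<close>

lemma dot_diagonal_index:
  assumes "i \<in> dot_indices n"
  shows "fst (dot n i) + snd (dot n i) + 2 * i =
    n + 2 * (n div 3) + 1 + (if i \<le> n div 3 then 0 else 2 * (n div 3) + 1)"
proof -
  define k where "k = n div 3"
  have "3 * k \<le> n" "i \<le> 2 * k"
    using assms by (auto simp: dot_indices_def k_def)
  then have "n - i + (if i \<le> k then 2 * k + 1 - i else 4 * k + 2 - i) + 2 * i =
      n + 2 * k + 1 + (if i \<le> k then 0 else 2 * k + 1)"
    by simp
  then show ?thesis
    unfolding dot_def k_def Let_def fst_conv snd_conv .
qed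

lemma inj_on_dot_diagonal: "inj_on (\<lambda>i. fst (dot n i) + snd (dot n i)) (dot_indices n)"
proof (rule inj_onI)
  fix i j
  assume ij: "i \<in> dot_indices n" "j \<in> dot_indices n"
    and eq: "fst (dot n i) + snd (dot n i) = fst (dot n j) + snd (dot n j)"
  have "(if j \<le> n div 3 then 0 else 2 * (n div 3) + 1) + 2 * i =
      (if i \<le> n div 3 then 0 else 2 * (n div 3) + 1) + 2 * j"
    using eq dot_diagonal_index[OF ij(1)] dot_diagonal_index[OF ij(2)] by linarith
  \<comment> \<open>If \<open>i\<close> and \<open>j\<close> lie in different runs, the odd offset
    \<open>2 * (n div 3) + 1\<close> contradicts parity.\<close>
  then show "i = j"
    by (cases "i \<le> n div 3"; cases "j \<le> n div 3"; simp; presburger)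
qed

lemma card_dot_indices:
  assumes "n \<ge> 1"
  shows "int (card (dot_indices n)) = (2 * int n + 1) div 3"
proof (cases "n mod 3 = 0")
  case True
  \<comment> \<open>This gives \<open>k + 1 \<le> 2 * k\<close>, so the removed index really is in
    the range and lowers the count by one.\<close>
  then have "n div 3 \<ge> 1" using assms by presburger
  then have "card (dot_indices n) = 2 * (n div 3)"
    using True by (simp add: dot_indices_def)
  then show ?thesis using True by presburger
next
  case False
  then have "card (dot_indices n) = 2 * (n div 3) + 1"
    by (simp add: dot_indices_def)
  then show ?thesis using False by presburger
qed

text \<open>Rows, columns and diagonals all lie in fibres of a coordinate function \<open>g\<close>,
  so one argument serves all three.\<close>

lemma card_image_fibre_le_1:
  assumes "inj_on (\<lambda>i. g (f i)) I" and "\<And>p. p \<in> S \<Longrightarrow> g p = c"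
  shows "card (f ` I \<inter> S) \<le> 1"
proof -
  have "p = q" if "p \<in> f ` I \<inter> S" "q \<in> f ` I \<inter> S" for p q
    using that assms by (auto dest: inj_onD)
  then show ?thesis
    \<comment> \<open>Finiteness is not assumed: an infinite set has \<open>card\<close> 0.\<close>
    by (metis card_le_Suc0_iff_eq One_nat_def card.infinite zero_le_one)
qed

lemma valid_placement_dots:
  assumes "n \<ge> 1"
  shows "valid_placement n (dot n ` dot_indices n)"
  unfolding valid_placement_def
proof (intro conjI allI)
  show "dot n ` dot_indices n \<subseteq> triangle n"
    using dot_in_triangle[OF assms] by blast
  show "card (dot n ` dot_indices n \<inter> row n i) \<le> 1" for i
    by (rule card_image_fibre_le_1[where g = fst and c = i, OF inj_on_dot_row]) (auto simp: row_def)
  show "card (dot n ` dot_indices n \<inter> column n j) \<le> 1" for j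
    by (rule card_image_fibre_le_1[where g = snd and c = j, OF inj_on_dot_column]) (auto simp: column_def)
  show "card (dot n ` dot_indices n \<inter> diagonal n s) \<le> 1" for s
    by (rule card_image_fibre_le_1[where g = "\<lambda>p. fst p + snd p" and c = s,
          OF inj_on_dot_diagonal]) (auto simp: diagonal_def)
qed

theorem theorem2:
  fixes n :: nat
  assumes "n \<ge> 1"
  shows "int (max_dots n) \<ge> \<lfloor>(2 * real n + 1) / 3\<rfloor>"
proof -
  have "inj_on (dot n) (dot_indices n)"
    using inj_on_dot_row[of n] by (auto simp: inj_on_def)
  then have "card (dot_indices n) = card (dot n ` dot_indices n)"
    by (simp add: card_image)
  also have "\<dots> \<le> max_dots n"
    unfolding max_dots_def
    by (rule Max_ge[OF finite_dot_counts]) (use valid_placement_dots[OF assms] in blast)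
  finally have "(2 * int n + 1) div 3 \<le> int (max_dots n)"
    using card_dot_indices[OF assms] by linarith
  moreover have "\<lfloor>(2 * real n + 1) / 3\<rfloor> = (2 * int n + 1) div 3"
    using floor_divide_of_int_eq[of "2 * int n + 1" 3, where 'a = real] by simp
  ultimately show ?thesis by simp
qed

end
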